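(* Suppose that $M_1$ and $M_2$ are compact metric spaces and that $Z_1\subset M_1$ and $Z_2\subset M_2$ are closed nowhere dense subspaces. Then $M_1\setminus Z_1$ and $M_2\setminus Z_2$ (with the restricted metrics) are coarsely equivalent as $C_0$ coarse spaces if and only if $Z_1$ and $Z_2$ are homeomorphic.
   Context: A coarse structure on a set $X$ is a collection $\mathcal{E}$ of subsets of $X\times X$, called controlled sets, that contains the diagonal and is closed under taking subsets, inverses $E^{-1}=\{(x,y):(y,x)\in E\}$, compositions $E\circ F=\{(x,z): \exists y,\ (x,y)\in E,\ (y,z)\in F\}$, and finite unions. A subset $B\subset X$ is bounded if $B\times B$ is controlled. A (not necessarily continuous) map $f\colon X\to Y$ of coarse spaces is coarse if $f^{-1}(B)$ is bounded for every bounded $B\subset Y$ and $(f\times f)(E)$ is controlled for every controlled $E\subset X\times X$. Maps $f,g\colon S\to Y$ from a set to a coarse space are close if $\{(f(s),g(s)): s\in S\}$ is controlled. Coarse spaces $X,Y$ are coarsely equivalent if there are coarse maps $f\colon X\to Y$, $g\colon Y\to X$ with $g\circ f$ close to $\mathrm{id}_X$ and $f\circ g$ close to $\mathrm{id}_Y$. The $C_0$ coarse structure on a locally compact metric space $(X,d)$: $E\subset X\times X$ is controlled iff for every $\varepsilon>0$ there is a compact $K\subset X$ such that $d(x,y)<\varepsilon$ for all $(x,y)\in E\setminus (K\times K)$. *)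

theory Defs
  imports "HOL-Analysis.Analysis"
begin

text \<open>
  A coarse space is given by a carrier set \<open>X\<close> together with its collection \<open>\<E>\<close> of controlled
  subsets of \<open>X \<times> X\<close>; maps between coarse spaces are constrained on the carrier only.
\<close>

definition coarse_structure :: "'a set \<Rightarrow> ('a \<times> 'a) set set \<Rightarrow> bool" where
  "coarse_structure X \<E> \<longleftrightarrow>
     \<E> \<subseteq> Pow (X \<times> X) \<and>
     Id_on X \<in> \<E> \<and>
     (\<forall>E F. E \<in> \<E> \<and> F \<subseteq> E \<longrightarrow> F \<in> \<E>) \<and>
     (\<forall>E \<in> \<E>. E\<inverse> \<in> \<E>) \<and>
     (\<forall>E \<in> \<E>. \<forall>F \<in> \<E>. E O F \<in> \<E>) \<and>
     (\<forall>E \<in> \<E>. \<forall>F \<in> \<E>. E \<union> F \<in> \<E>)"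

definition coarsely_bounded :: "'a set \<Rightarrow> ('a \<times> 'a) set set \<Rightarrow> 'a set \<Rightarrow> bool" where
  "coarsely_bounded X \<E> B \<longleftrightarrow> B \<subseteq> X \<and> B \<times> B \<in> \<E>"

definition coarse_map ::
    "'a set \<Rightarrow> ('a \<times> 'a) set set \<Rightarrow> 'b set \<Rightarrow> ('b \<times> 'b) set set \<Rightarrow> ('a \<Rightarrow> 'b) \<Rightarrow> bool" where
  "coarse_map X \<E> Y \<F> f \<longleftrightarrow>
     f ` X \<subseteq> Y \<and>
     (\<forall>B. coarsely_bounded Y \<F> B \<longrightarrow> coarsely_bounded X \<E> {x \<in> X. f x \<in> B}) \<and>
     (\<forall>E \<in> \<E>. map_prod f f ` E \<in> \<F>)"

definition close_maps ::
    "'s set \<Rightarrow> ('b \<times> 'b) set set \<Rightarrow> ('s \<Rightarrow> 'b) \<Rightarrow> ('s \<Rightarrow> 'b) \<Rightarrow> bool" where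
  "close_maps S \<F> f g \<longleftrightarrow> (\<lambda>s. (f s, g s)) ` S \<in> \<F>"

definition coarsely_equivalent ::
    "'a set \<Rightarrow> ('a \<times> 'a) set set \<Rightarrow> 'b set \<Rightarrow> ('b \<times> 'b) set set \<Rightarrow> bool" where
  "coarsely_equivalent X \<E> Y \<F> \<longleftrightarrow>
     (\<exists>f g. coarse_map X \<E> Y \<F> f \<and> coarse_map Y \<F> X \<E> g \<and>
            close_maps X \<E> (g \<circ> f) id \<and> close_maps Y \<F> (f \<circ> g) id)"

definition C0_structure :: "'a::metric_space set \<Rightarrow> ('a \<times> 'a) set set" where
  "C0_structure X =
     {E. E \<subseteq> X \<times> X \<and>
         (\<forall>\<epsilon>>0. \<exists>K. compact K \<and> K \<subseteq> X \<and> (\<forall>(x, y) \<in> E - K \<times> K. dist x y < \<epsilon>))}"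

definition nowhere_dense_in :: "'a topology \<Rightarrow> 'a set \<Rightarrow> bool" where
  "nowhere_dense_in T S \<longleftrightarrow> S \<subseteq> topspace T \<and> T interior_of (T closure_of S) = {}"

lemma compact_uniform_nhd:
  fixes X :: "'a::metric_space set"
  assumes X: "locally_compact_space (top_of_set X)" and K: "compact K" "K \<subseteq> X"
  obtains \<delta> L where "\<delta> > 0" "compact L" "L \<subseteq> X"
    "\<And>x y. x \<in> K \<Longrightarrow> y \<in> X \<Longrightarrow> dist x y < \<delta> \<Longrightarrow> y \<in> L"
proof -
  have "\<exists>W C. open W \<and> compact C \<and> C \<subseteq> X \<and> x \<in> W \<and> W \<inter> X \<subseteq> C" if "x \<in> K" for x
  proof -
    have "x \<in> topspace (top_of_set X)" using K that by auto
    with X obtain U C where U: "openin (top_of_set X) U" "x \<in> U" "U \<subseteq> C"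
      and C: "compactin (top_of_set X) C"
      unfolding locally_compact_space_def by meson
    from U(1) obtain T where "open T" "U = X \<inter> T" by (auto simp: openin_open)
    moreover have "compact C" "C \<subseteq> X" using C by (auto simp: compactin_subtopology)
    ultimately show ?thesis using U(2,3) by (intro exI[of _ T] exI[of _ C]) auto
  qed
  then obtain W C where W: "\<And>x. x \<in> K \<Longrightarrow> open (W x)" "\<And>x. x \<in> K \<Longrightarrow> x \<in> W x"
    and C: "\<And>x. x \<in> K \<Longrightarrow> compact (C x)" "\<And>x. x \<in> K \<Longrightarrow> C x \<subseteq> X"
           "\<And>x. x \<in> K \<Longrightarrow> W x \<inter> X \<subseteq> C x"
    by metis
  obtain D where D: "D \<subseteq> K" "finite D" "K \<subseteq> (\<Union>x\<in>D. W x)"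
  proof (rule compactE_image[OF K(1), of K W])
    show "K \<subseteq> (\<Union>x\<in>K. W x)" using W(2) by blast
  qed (use W(1) in auto)
  obtain e where e: "e > 0" "\<forall>x \<in> K. \<exists>G \<in> W ` D. ball x e \<subseteq> G"
    using Heine_Borel_lemma[OF K(1) D(3)] W(1) D(1) by (metis imageE subsetD)
  show thesis
  proof (rule that[of e "\<Union>x\<in>D. C x"])
    show "compact (\<Union>x\<in>D. C x)" using D C by (intro compact_UN) auto
    show "(\<Union>x\<in>D. C x) \<subseteq> X" using D C by blast
    show "y \<in> (\<Union>x\<in>D. C x)" if xy: "x \<in> K" "y \<in> X" "dist x y < e" for x y
    proof -
      obtain d where d: "d \<in> D" "ball x e \<subseteq> W d" using e(2) xy(1) by blast
      have "y \<in> W d" using d(2) xy(3) by (simp add: subset_iff)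
      then show ?thesis using C(3) d(1) D(1) xy(2) by blast
    qed
  qed (use e in auto)
qed

lemma coarse_structure_C0:
  fixes X :: "'a::metric_space set"
  assumes X: "locally_compact_space (top_of_set X)"
  shows "coarse_structure X (C0_structure X)"
proof -
  have sub: "E \<subseteq> X \<times> X" if "E \<in> C0_structure X" for E
    using that by (auto simp: C0_structure_def)
  have iff: "E \<in> C0_structure X \<longleftrightarrow> E \<subseteq> X \<times> X \<and> (\<forall>\<epsilon>>0. \<exists>K. compact K \<and> K \<subseteq> X \<and>
      (\<forall>x y. (x, y) \<in> E \<longrightarrow> x \<notin> K \<or> y \<notin> K \<longrightarrow> dist x y < \<epsilon>))" for E
  proof -
    have "(\<forall>(x, y) \<in> E - K \<times> K. dist x y < \<epsilon>) \<longleftrightarrow>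
        (\<forall>x y. (x, y) \<in> E \<longrightarrow> x \<notin> K \<or> y \<notin> K \<longrightarrow> dist x y < \<epsilon>)" for K and \<epsilon> :: real
      by auto
    then show ?thesis by (simp add: C0_structure_def)
  qed
  have C0D: "\<exists>K. compact K \<and> K \<subseteq> X \<and> (\<forall>x y. (x, y) \<in> E \<longrightarrow> x \<notin> K \<or> y \<notin> K \<longrightarrow> dist x y < \<epsilon>)"
    if "E \<in> C0_structure X" "\<epsilon> > 0" for E and \<epsilon> :: real
    using that unfolding iff by simp
  have C0I: "E \<in> C0_structure X" if "E \<subseteq> X \<times> X"
    "\<And>\<epsilon>. \<epsilon> > 0 \<Longrightarrow> \<exists>K. compact K \<and> K \<subseteq> X \<and>
      (\<forall>x y. (x, y) \<in> E \<longrightarrow> x \<notin> K \<or> y \<notin> K \<longrightarrow> dist x y < \<epsilon>)" for E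
    using that unfolding iff by simp
  have C0D2: "\<exists>K. compact K \<and> K \<subseteq> X \<and>
      (\<forall>x y. (x, y) \<in> E \<union> F \<longrightarrow> x \<notin> K \<or> y \<notin> K \<longrightarrow> dist x y < \<epsilon>)"
    if EF: "E \<in> C0_structure X" "F \<in> C0_structure X" and "\<epsilon> > 0" for E F and \<epsilon> :: real
  proof -
    obtain K1 K2 where "compact K1" "K1 \<subseteq> X" "compact K2" "K2 \<subseteq> X"
      "\<forall>x y. (x, y) \<in> E \<longrightarrow> x \<notin> K1 \<or> y \<notin> K1 \<longrightarrow> dist x y < \<epsilon>"
      "\<forall>x y. (x, y) \<in> F \<longrightarrow> x \<notin> K2 \<or> y \<notin> K2 \<longrightarrow> dist x y < \<epsilon>"
      using C0D[OF EF(1) \<open>\<epsilon> > 0\<close>] C0D[OF EF(2) \<open>\<epsilon> > 0\<close>] by blast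
    then show ?thesis by (intro exI[of _ "K1 \<union> K2"]) auto
  qed
  have id: "Id_on X \<in> C0_structure X"
    by (rule C0I) (auto intro!: exI[of _ "{}"])
  have down: "F \<in> C0_structure X" if "E \<in> C0_structure X" "F \<subseteq> E" for E F
  proof (rule C0I)
    show "F \<subseteq> X \<times> X" using sub[OF that(1)] that(2) by (rule subset_trans[rotated])
    fix \<epsilon> :: real assume "\<epsilon> > 0"
    from C0D[OF that(1) this] show "\<exists>K. compact K \<and> K \<subseteq> X \<and>
        (\<forall>x y. (x, y) \<in> F \<longrightarrow> x \<notin> K \<or> y \<notin> K \<longrightarrow> dist x y < \<epsilon>)"
      using that(2) by (elim ex_forward) blast
  qed
  have conv: "E\<inverse> \<in> C0_structure X" if "E \<in> C0_structure X" for E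
  proof (rule C0I)
    show "E\<inverse> \<subseteq> X \<times> X" using sub[OF that] by blast
    fix \<epsilon> :: real assume "\<epsilon> > 0"
    from C0D[OF that this] show "\<exists>K. compact K \<and> K \<subseteq> X \<and>
        (\<forall>x y. (x, y) \<in> E\<inverse> \<longrightarrow> x \<notin> K \<or> y \<notin> K \<longrightarrow> dist x y < \<epsilon>)"
      by (elim ex_forward) (metis converse_iff dist_commute)
  qed
  have un: "E \<union> F \<in> C0_structure X" if "E \<in> C0_structure X" "F \<in> C0_structure X" for E F
    by (rule C0I[OF _ C0D2[OF that]]) (use sub[OF that(1)] sub[OF that(2)] in auto)
  have comp: "E O F \<in> C0_structure X" if EF: "E \<in> C0_structure X" "F \<in> C0_structure X" for E F
  proof (rule C0I)
    show "E O F \<subseteq> X \<times> X" using sub[OF EF(1)] sub[OF EF(2)] by blast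
    fix \<epsilon> :: real assume "\<epsilon> > 0"
    then have "\<epsilon> / 2 > 0" by simp
    then obtain K where K: "compact K" "K \<subseteq> X"
      "\<And>x y. (x, y) \<in> E \<union> F \<Longrightarrow> x \<notin> K \<or> y \<notin> K \<Longrightarrow> dist x y < \<epsilon> / 2"
      using C0D2[OF EF] by meson
    obtain \<delta> L where L: "\<delta> > 0" "compact L" "L \<subseteq> X"
      "\<And>x y. x \<in> K \<Longrightarrow> y \<in> X \<Longrightarrow> dist x y < \<delta> \<Longrightarrow> y \<in> L"
      using compact_uniform_nhd[OF X K(1,2)] by metis
    obtain K' where K': "compact K'" "K' \<subseteq> X"
      "\<And>x y. (x, y) \<in> E \<union> F \<Longrightarrow> x \<notin> K' \<or> y \<notin> K' \<Longrightarrow> dist x y < \<delta>"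
      using C0D2[OF EF L(1)] by meson
    have "dist x z < \<epsilon>" if xz: "(x, z) \<in> E O F" "x \<notin> K \<union> L \<union> K' \<or> z \<notin> K \<union> L \<union> K'" for x z
    proof -
      obtain y where y: "(x, y) \<in> E" "(y, z) \<in> F" using xz(1) by blast
      have X3: "x \<in> X" "z \<in> X" using y sub[OF EF(1)] sub[OF EF(2)] by auto
      have "y \<notin> K \<or> x \<notin> K \<and> z \<notin> K"
      proof (rule ccontr)
        assume *: "\<not> ?thesis"
        then have "y \<in> K" by blast
        show False
        proof (cases "x \<in> K \<union> L \<union> K'")
          case False
          then have "dist y x < \<delta>" using K'(3)[of x y] y by (simp add: dist_commute)
          then show False using L(4)[OF \<open>y \<in> K\<close> X3(1)] False by blast
        next
          case True
          then have "z \<notin> K \<union> L \<union> K'" using xz(2) by blast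
          moreover from this have "dist y z < \<delta>" using K'(3)[of y z] y by simp
          ultimately show False using L(4)[OF \<open>y \<in> K\<close> X3(2)] by blast
        qed
      qed
      then have "dist x y < \<epsilon> / 2" "dist y z < \<epsilon> / 2"
        using K(3)[of x y] K(3)[of y z] y by auto
      then show ?thesis using dist_triangle[of x z y] by linarith
    qed
    then show "\<exists>K. compact K \<and> K \<subseteq> X \<and>
        (\<forall>x z. (x, z) \<in> E O F \<longrightarrow> x \<notin> K \<or> z \<notin> K \<longrightarrow> dist x z < \<epsilon>)"
      using K(1,2) L(2,3) K'(1,2) by (intro exI[of _ "K \<union> L \<union> K'"]) auto
  qed
  show ?thesis
    unfolding coarse_structure_def
  proof (intro conjI allI ballI impI)
    show "C0_structure X \<subseteq> Pow (X \<times> X)" using sub by (intro subsetI) (rule PowI)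
    show "F \<in> C0_structure X" if "E \<in> C0_structure X \<and> F \<subseteq> E" for E F
      using that by (elim conjE) (rule down)
  qed (rule id conv comp un; assumption?)+
qed

lemma locally_compact_compact_diff:
  fixes M :: "'a::metric_space set"
  assumes "compact M" "closedin (top_of_set M) Z"
  shows "locally_compact_space (top_of_set (M - Z))"
proof -
  have "locally_compact_space (subtopology (top_of_set M) (M - Z))"
  proof (rule locally_compact_space_open_subset)
    show "Hausdorff_space (top_of_set M) \<or> regular_space (top_of_set M)"
      by (simp add: Hausdorff_space_subtopology)
    show "locally_compact_space (top_of_set M)"
      using assms(1) by (simp add: compact_imp_locally_compact_space compact_space_subtopology)
    show "openin (top_of_set M) (M - Z)"
      using assms(2) by (simp add: openin_diff)
  qed
  then show ?thesis by (simp add: subtopology_subtopology Int_absorb1)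
qed

end

theory Submission
  imports Defs
begin

text \<open>
  Controlled sets of \<open>M - Z\<close> are those whose closure in \<open>M \<times> M\<close> meets \<open>Z \<times> M \<union> M \<times> Z\<close> only in the
  diagonal. Hence a coarse map \<open>M - Z \<rightarrow> N - W\<close> extends continuously to a map \<open>Z \<rightarrow> W\<close>, close maps
  have the same extension, and a coarse equivalence induces a homeomorphism. Conversely, a continuous
  \<open>h : Z \<rightarrow> W\<close> is the extension of the map that sends \<open>x\<close> to a point near \<open>h z\<close>, where \<open>z \<in> Z\<close> is
  nearest to \<open>x\<close>; this point is taken from a finite subset of \<open>N - W\<close> that becomes finer as \<open>x\<close>
  approaches \<open>Z\<close>.
\<close>

section \<open>Compact sets and nearest points\<close>

lemma compact_closed_subset: "compact S \<Longrightarrow> closed T \<Longrightarrow> T \<subseteq> S \<Longrightarrow> compact T"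
  using compact_Int_closed[of S T] by (simp add: Int_absorb1)

lemma compact_insert_limit_range:
  fixes x :: "nat \<Rightarrow> 'a::metric_space"
  assumes "x \<longlonglongrightarrow> a"
  shows "compact (insert a (range x))"
  using compactin_sequence_with_limit[of euclidean x a "range x"] assms by simp

lemma infdist_attained_on_compact:
  assumes "compact Z" "Z \<noteq> {}"
  shows "\<exists>z\<in>Z. infdist x Z = dist x z"
proof -
  obtain z where z: "z \<in> Z" "\<forall>y\<in>Z. dist x z \<le> dist x y"
    using continuous_attains_inf[OF assms, of "\<lambda>z. dist x z",
        OF continuous_on_dist[OF continuous_on_const continuous_on_id]] by blast
  have "dist x z \<le> infdist x Z"
    using z(2) assms(2) by (auto simp: infdist_notempty intro: cINF_greatest)
  then show ?thesis using z(1) infdist_le[OF z(1)] by (intro bexI[of _ z] antisym) auto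
qed

section \<open>Controlled and bounded sets in terms of sequences\<close>

text \<open>A sequence tending to a point of \<open>Z\<close> leaves every compact subset of
  \<open>M - Z\<close>, which gives one direction. For the other, compactness of \<open>M\<close>
  produces the required \<open>K\<close> from the pairs whose distance is bounded below.\<close>

lemma C0_structure_iff_sequentially:
  fixes M Z :: "'a::metric_space set"
  assumes M: "compact M"
  shows "E \<in> C0_structure (M - Z) \<longleftrightarrow> E \<subseteq> (M - Z) \<times> (M - Z) \<and>
    (\<forall>x y a b. (\<forall>n. (x n, y n) \<in> E) \<longrightarrow> x \<longlonglongrightarrow> a \<longrightarrow> y \<longlonglongrightarrow> b \<longrightarrow> a \<in> Z \<or> b \<in> Z \<longrightarrow> a = b)"
    (is "_ \<longleftrightarrow> _ \<and> ?S")
proof (intro iffI conjI)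
  assume E: "E \<in> C0_structure (M - Z)"
  show "E \<subseteq> (M - Z) \<times> (M - Z)" using E by (auto simp: C0_structure_def)
  show ?S
  proof (intro allI impI)
    fix x y a b
    assume xy: "\<forall>n. (x n, y n) \<in> E" and lim: "x \<longlonglongrightarrow> a" "y \<longlonglongrightarrow> b" and ab: "a \<in> Z \<or> b \<in> Z"
    have "dist a b \<le> e" if "e > 0" for e
    proof -
      obtain K where K: "compact K" "K \<subseteq> M - Z" "\<forall>(x, y) \<in> E - K \<times> K. dist x y < e"
        using E \<open>e > 0\<close> unfolding C0_structure_def by blast
      \<comment> \<open>\<open>K\<close> misses \<open>Z\<close>, so whichever sequence has its
        limit in \<open>Z\<close> is eventually outside \<open>K\<close>; one coordinate outside is
        enough to bound the distance.\<close>
      have op: "open (- K)" using K(1) compact_imp_closed by auto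
      have "\<forall>\<^sub>F n in sequentially. x n \<notin> K \<or> y n \<notin> K"
      proof (cases "a \<in> Z")
        case True
        then have "\<forall>\<^sub>F n in sequentially. x n \<in> - K"
          using topological_tendstoD[OF lim(1) op] K(2) by auto
        then show ?thesis by eventually_elim auto
      next
        case False
        then have "\<forall>\<^sub>F n in sequentially. y n \<in> - K"
          using topological_tendstoD[OF lim(2) op] K(2) ab by auto
        then show ?thesis by eventually_elim auto
      qed
      then have "\<forall>\<^sub>F n in sequentially. dist (x n) (y n) \<le> e"
        by eventually_elim (use K(3) xy in force)
      then show ?thesis
        using tendsto_upperbound[OF tendsto_dist[OF lim]] by simp
    qed
    then have "dist a b \<le> 0" by (rule field_le_epsilon[of _ 0, simplified])
    then show "a = b" by simp
  qed
next
  assume *: "E \<subseteq> (M - Z) \<times> (M - Z) \<and> ?S"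
  have "\<exists>K. compact K \<and> K \<subseteq> M - Z \<and> (\<forall>(x, y) \<in> E - K \<times> K. dist x y < e)" if "e > 0" for e
  proof -
    \<comment> \<open>The limits of pairs of \<open>E\<close> whose coordinates stay at least
      \<open>e\<close> apart. The two coordinates differ, so by the sequential condition neither
      lies in \<open>Z\<close>. The union of the two projections of \<open>C\<close> is therefore a
      compact \<open>K\<close> inside \<open>M - Z\<close>.\<close>
    define C where "C = closure E \<inter> {p. e \<le> dist (fst p) (snd p)}"
    have sub: "closure E \<subseteq> M \<times> M"
      using * M by (intro closure_minimal) (auto simp: compact_Times compact_imp_closed)
    have "closed C" unfolding C_def
      by (intro closed_Int closed_closure closed_Collect_le continuous_intros)
    then have "compact C"
      using compact_closed_subset[OF compact_Times[OF M M]] sub by (auto simp: C_def)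
    then have cpt: "compact (fst ` C \<union> snd ` C)"
      by (intro compact_Un compact_continuous_image continuous_intros)
    have "a \<notin> Z \<and> b \<notin> Z" if "(a, b) \<in> C" for a b
    proof -
      have "(a, b) \<in> closure E" using that by (simp add: C_def)
      then obtain p where p: "\<forall>n. p n \<in> E" "p \<longlonglongrightarrow> (a, b)"
        unfolding closure_sequential by blast
      have "a \<noteq> b" using that \<open>e > 0\<close> by (auto simp: C_def)
      have S: ?S using * by blast
      have lim: "(\<lambda>n. fst (p n)) \<longlonglongrightarrow> a" "(\<lambda>n. snd (p n)) \<longlonglongrightarrow> b"
        using tendsto_fst[OF p(2)] tendsto_snd[OF p(2)] by simp_all
      have "a \<in> Z \<or> b \<in> Z \<Longrightarrow> a = b"
        by (rule S[rule_format, OF _ lim]) (use p(1) in auto)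
      then show ?thesis using \<open>a \<noteq> b\<close> by blast
    qed
    then have "fst ` C \<union> snd ` C \<subseteq> M - Z" using sub by (force simp: C_def)
    moreover have "dist x y < e" if "(x, y) \<in> E - (fst ` C \<union> snd ` C) \<times> (fst ` C \<union> snd ` C)" for x y
    proof (rule ccontr)
      assume "\<not> dist x y < e"
      then have "(x, y) \<in> C" using that closure_subset[of E] by (auto simp: C_def)
      then show False using that by force
    qed
    ultimately show ?thesis
      using cpt by (intro exI[of _ "fst ` C \<union> snd ` C"]) (auto simp del: Un_subset_iff)
  qed
  then show "E \<in> C0_structure (M - Z)" using * by (simp add: C0_structure_def)
qed

lemma C0_structure_tendsto_eq:
  fixes M Z :: "'a::metric_space set"
  assumes "compact M" "E \<in> C0_structure (M - Z)" "\<And>n. (x n, y n) \<in> E" "x \<longlonglongrightarrow> a" "y \<longlonglongrightarrow> b"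
    and "a \<in> Z \<or> b \<in> Z"
  shows "a = b"
  using assms(2-) unfolding C0_structure_iff_sequentially[OF assms(1)] by blast

text \<open>If a sequence of \<open>B\<close> tended to a point of \<open>Z\<close>, pairing it with
  its constant first term inside \<open>B \<times> B\<close> would force that limit to equal a point
  of \<open>M - Z\<close>. So the closure of \<open>B\<close> avoids \<open>Z\<close>.\<close>

lemma coarsely_bounded_C0_iff:
  fixes M Z :: "'a::metric_space set"
  assumes M: "compact M"
  shows "coarsely_bounded (M - Z) (C0_structure (M - Z)) B \<longleftrightarrow>
    (\<exists>K. compact K \<and> K \<subseteq> M - Z \<and> B \<subseteq> K)" (is "?L \<longleftrightarrow> ?R")
proof
  assume L: ?L
  then have B: "B \<subseteq> M - Z" "B \<times> B \<in> C0_structure (M - Z)"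
    by (auto simp: coarsely_bounded_def)
  have sub: "closure B \<subseteq> M"
    using B M by (intro closure_minimal) (auto simp: compact_imp_closed)
  then have "compact (closure B)"
    using compact_closed_subset[OF M] by auto
  moreover have "a \<notin> Z" if "a \<in> closure B" for a
  proof
    assume "a \<in> Z"
    obtain x where x: "\<forall>n. x n \<in> B" "x \<longlonglongrightarrow> a"
      using \<open>a \<in> closure B\<close> unfolding closure_sequential by blast
    have "a = x 0"
      using C0_structure_tendsto_eq[OF M B(2) _ x(2) tendsto_const] x(1) \<open>a \<in> Z\<close> by blast
    then show False using x(1) B(1) \<open>a \<in> Z\<close> by auto
  qed
  ultimately show ?R using sub closure_subset[of B] by blast
next
  assume ?R
  then obtain K where "compact K" "K \<subseteq> M - Z" "B \<subseteq> K" by blast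
  then show ?L by (auto simp: coarsely_bounded_def C0_structure_def intro!: exI[of _ K])
qed

section \<open>Maps with a limit at every boundary point\<close>

text \<open>\<open>f\<close> may be discontinuous on \<open>M - Z\<close>. The last clause replaces
  continuity there: it keeps the image of a compact set away from \<open>W\<close>.\<close>

definition boundary_map ::
    "'a::metric_space set \<Rightarrow> 'a set \<Rightarrow> 'b::metric_space set \<Rightarrow> 'b set \<Rightarrow>
     ('a \<Rightarrow> 'b) \<Rightarrow> ('a \<Rightarrow> 'b) \<Rightarrow> bool" where
  "boundary_map M Z N W f h \<longleftrightarrow> f ` (M - Z) \<subseteq> N - W \<and> h ` Z \<subseteq> W \<and>
     (\<forall>z\<in>Z. (f \<longlongrightarrow> h z) (at z within M - Z)) \<and>
     (\<forall>K. compact K \<longrightarrow> K \<subseteq> M - Z \<longrightarrow> (\<exists>L. compact L \<and> L \<subseteq> N - W \<and> f ` K \<subseteq> L))"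

lemma boundary_map_image:
  "boundary_map M Z N W f h \<Longrightarrow> x \<in> M - Z \<Longrightarrow> f x \<in> N - W"
  "boundary_map M Z N W f h \<Longrightarrow> z \<in> Z \<Longrightarrow> h z \<in> W"
  by (auto simp: boundary_map_def)

lemma tendsto_within_sequence:
  fixes x :: "nat \<Rightarrow> 'a::metric_space"
  assumes "(f \<longlongrightarrow> l) (at z within S)" "z \<notin> S" "\<And>n. x n \<in> S" "x \<longlonglongrightarrow> z"
  shows "(\<lambda>n. f (x n)) \<longlonglongrightarrow> l"
proof -
  have "\<forall>n. x n \<in> S - {z}" using assms(2,3) by (metis Diff_iff singletonD)
  then show ?thesis
    using assms(1,4) unfolding tendsto_at_iff_sequentially comp_def by blast
qed

lemma tendsto_dist_bound:
  assumes "\<And>n. dist (y n) z \<le> b n" "b \<longlonglongrightarrow> 0"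
  shows "y \<longlonglongrightarrow> z"
proof (rule iffD2[OF tendsto_dist_iff])
  show "(\<lambda>n. dist (y n) z) \<longlonglongrightarrow> 0"
    by (rule tendsto_sandwich[OF _ _ tendsto_const assms(2)]) (simp_all add: assms(1))
qed

lemma tendsto_close_sequence:
  fixes x y :: "nat \<Rightarrow> 'a::metric_space"
  assumes x: "x \<longlonglongrightarrow> z" and close: "\<And>n. dist (y n) (x n) < inverse (real (Suc n))"
  shows "y \<longlonglongrightarrow> z"
proof (rule tendsto_dist_bound)
  show "dist (y n) z \<le> inverse (real (Suc n)) + dist (x n) z" for n
    using dist_triangle[of "y n" z "x n"] close[of n] by linarith
  show "(\<lambda>n. inverse (real (Suc n)) + dist (x n) z) \<longlonglongrightarrow> 0"
    using tendsto_add[OF LIMSEQ_inverse_real_of_nat iffD1[OF tendsto_dist_iff x]] by simp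
qed

lemma boundary_map_tendsto:
  assumes "boundary_map M Z N W f h" "\<And>n. x n \<in> M - Z" "x \<longlonglongrightarrow> z" "z \<in> Z"
  shows "(\<lambda>n. f (x n)) \<longlonglongrightarrow> h z"
  using assms by (intro tendsto_within_sequence[of f _ z "M - Z"]) (auto simp: boundary_map_def)

text \<open>As \<open>f\<close> may jump at \<open>a\<close>, the limit \<open>c\<close> can differ
  from \<open>f a\<close>. Still, the sequence together with \<open>a\<close> is compact, so its
  image stays in a compact, hence closed, subset of \<open>N - W\<close>.\<close>

lemma boundary_map_interior_limit:
  assumes f: "boundary_map M Z N W f h" and x: "\<And>n. x n \<in> M - Z" "x \<longlonglongrightarrow> a" "a \<in> M - Z"
    and c: "(\<lambda>n. f (x n)) \<longlonglongrightarrow> c"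
  shows "c \<in> N - W"
proof -
  have "compact (insert a (range x))" by (rule compact_insert_limit_range[OF x(2)])
  moreover have "insert a (range x) \<subseteq> M - Z" using x by auto
  ultimately obtain L where L: "compact L" "L \<subseteq> N - W" "f ` insert a (range x) \<subseteq> L"
    using f unfolding boundary_map_def by metis
  have "c \<in> L"
    by (rule closed_sequentially[OF compact_imp_closed[OF L(1)] _ c]) (use L(3) in auto)
  then show ?thesis using L by blast
qed

lemma boundary_map_compose:
  assumes f: "boundary_map M Z N W f h" and g: "boundary_map N W P V g k"
  shows "boundary_map M Z P V (g \<circ> f) (k \<circ> h)"
proof -
  have "((g \<circ> f) \<longlongrightarrow> (k \<circ> h) z) (at z within M - Z)" if "z \<in> Z" for z
    unfolding tendsto_at_iff_sequentially comp_def
  proof (intro allI impI)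
    fix x assume x: "\<forall>i. x i \<in> M - Z - {z}" "x \<longlonglongrightarrow> z"
    have "(\<lambda>n. f (x n)) \<longlonglongrightarrow> h z"
      by (rule boundary_map_tendsto[OF f]) (use x that in auto)
    moreover have "f (x n) \<in> N - W" for n
      by (rule boundary_map_image(1)[OF f]) (use x in auto)
    ultimately show "(\<lambda>n. g (f (x n))) \<longlonglongrightarrow> k (h z)"
      by (intro boundary_map_tendsto[OF g, where x = "\<lambda>n. f (x n)"])
        (use boundary_map_image(2)[OF f that] in auto)
  qed
  moreover have "\<exists>L. compact L \<and> L \<subseteq> P - V \<and> (g \<circ> f) ` K \<subseteq> L"
    if "compact K" "K \<subseteq> M - Z" for K
  proof -
    obtain L where L: "compact L" "L \<subseteq> N - W" "f ` K \<subseteq> L"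
      using f \<open>compact K\<close> \<open>K \<subseteq> M - Z\<close> unfolding boundary_map_def by metis
    obtain L' where "compact L'" "L' \<subseteq> P - V" "g ` L \<subseteq> L'"
      using g L unfolding boundary_map_def by metis
    then show ?thesis using L(3) by (intro exI[of _ L']) (auto simp: image_subset_iff)
  qed
  ultimately show ?thesis
    using f g unfolding boundary_map_def by (auto simp: image_subset_iff)
qed

lemma boundary_map_id: "(\<And>z. z \<in> Z \<Longrightarrow> h z = z) \<Longrightarrow> boundary_map M Z M Z id h"
  by (auto simp: boundary_map_def id_def)

text \<open>Two maps with a common \<open>h\<close> are treated at once, for two uses:
  \<open>f = g\<close> shows that controlled sets are preserved, and \<open>E\<close> the diagonal
  shows that the two maps are close.\<close>

lemma boundary_map_controlled:
  assumes M: "compact M" and N: "compact N"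
    and f: "boundary_map M Z N W f h" and g: "boundary_map M Z N W g h"
    and E: "E \<in> C0_structure (M - Z)"
  shows "map_prod f g ` E \<in> C0_structure (N - W)"
  unfolding C0_structure_iff_sequentially[OF N]
proof (intro conjI allI impI)
  have sub: "E \<subseteq> (M - Z) \<times> (M - Z)" using E by (auto simp: C0_structure_def)
  then show "map_prod f g ` E \<subseteq> (N - W) \<times> (N - W)"
    using boundary_map_image(1)[OF f] boundary_map_image(1)[OF g] by fastforce
  fix u v c d
  assume uv: "\<forall>n. (u n, v n) \<in> map_prod f g ` E" and lim: "u \<longlonglongrightarrow> c" "v \<longlonglongrightarrow> d"
    and cd: "c \<in> W \<or> d \<in> W"
  have "\<exists>p. p \<in> E \<and> u n = f (fst p) \<and> v n = g (snd p)" for n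
    using uv[rule_format, of n] by force
  then obtain p where p: "\<And>n. p n \<in> E" "\<And>n. u n = f (fst (p n))" "\<And>n. v n = g (snd (p n))"
    \<comment> \<open>Only the images are known to converge; compactness of
      \<open>M \<times> M\<close> lets the preimages converge too after passing to a
      subsequence.\<close>
    by metis
  have pM: "p n \<in> M \<times> M" "fst (p n) \<in> M - Z" "snd (p n) \<in> M - Z" for n using p(1)[of n] sub by auto
  obtain q r where q: "q \<in> M \<times> M" "strict_mono r" "(p \<circ> r) \<longlonglongrightarrow> q"
    using compact_Times[OF M M] pM(1) unfolding compact_def by metis
  define x y where "x = (\<lambda>n. fst (p (r n)))" and "y = (\<lambda>n. snd (p (r n)))"
  have xy: "x \<longlonglongrightarrow> fst q" "y \<longlonglongrightarrow> snd q" "\<And>n. x n \<in> M - Z" "\<And>n. y n \<in> M - Z" "\<And>n. (x n, y n) \<in> E"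
    using tendsto_fst[OF q(3)] tendsto_snd[OF q(3)] pM p(1) by (auto simp: x_def y_def comp_def)
  have fg: "(\<lambda>n. f (x n)) \<longlonglongrightarrow> c" "(\<lambda>n. g (y n)) \<longlonglongrightarrow> d"
    using LIMSEQ_subseq_LIMSEQ[OF lim(1) q(2)] LIMSEQ_subseq_LIMSEQ[OF lim(2) q(2)] p(2,3)
    by (simp_all add: comp_def x_def y_def)
  \<comment> \<open>If one limit of the preimages is in \<open>Z\<close>, both limits coincide
    because \<open>E\<close> is controlled, and \<open>h\<close> of that point is the limit of both
    images. Otherwise both images have limits in \<open>N - W\<close>, contrary to the choice of
    \<open>c\<close> and \<open>d\<close>.\<close>
  show "c = d"
  proof (cases "fst q \<in> Z \<or> snd q \<in> Z")
    case True
    then have eq: "fst q = snd q" using C0_structure_tendsto_eq[OF M E xy(5,1,2)] by blast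
    then have "(\<lambda>n. f (x n)) \<longlonglongrightarrow> h (fst q)" "(\<lambda>n. g (y n)) \<longlonglongrightarrow> h (fst q)"
      using boundary_map_tendsto[OF f xy(3,1)] boundary_map_tendsto[OF g xy(4,2)] True by auto
    then show ?thesis using fg LIMSEQ_unique by blast
  next
    case False
    then have "c \<in> N - W" "d \<in> N - W"
      using boundary_map_interior_limit[OF f xy(3,1) _ fg(1)]
        boundary_map_interior_limit[OF g xy(4,2) _ fg(2)] q(1) by auto
    then show ?thesis using cd by blast
  qed
qed

text \<open>For properness: if the preimage of a set inside a compact \<open>L\<close> accumulated
  at \<open>z \<in> Z\<close>, then \<open>h z\<close> would lie in \<open>L\<close>, although
  \<open>L\<close> misses \<open>W\<close>.\<close>

lemma boundary_map_imp_coarse_map: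
  assumes M: "compact M" and N: "compact N" and f: "boundary_map M Z N W f h"
  shows "coarse_map (M - Z) (C0_structure (M - Z)) (N - W) (C0_structure (N - W)) f"
  unfolding coarse_map_def
proof (intro conjI allI impI ballI)
  show "f ` (M - Z) \<subseteq> N - W" using f by (simp add: boundary_map_def)
  show "map_prod f f ` E \<in> C0_structure (N - W)" if "E \<in> C0_structure (M - Z)" for E
    by (rule boundary_map_controlled[OF M N f f that])
  fix B assume "coarsely_bounded (N - W) (C0_structure (N - W)) B"
  then obtain L where L: "compact L" "L \<subseteq> N - W" "B \<subseteq> L"
    using coarsely_bounded_C0_iff[OF N] by metis
  define A where "A = {x \<in> M - Z. f x \<in> B}"
  have sub: "closure A \<subseteq> M"
    using M by (intro closure_minimal) (auto simp: compact_imp_closed A_def)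
  have "z \<notin> Z" if "z \<in> closure A" for z
  proof
    assume "z \<in> Z"
    obtain x where x: "\<forall>n. x n \<in> A" "x \<longlonglongrightarrow> z"
      using \<open>z \<in> closure A\<close> unfolding closure_sequential by blast
    have "(\<lambda>n. f (x n)) \<longlonglongrightarrow> h z"
      by (rule boundary_map_tendsto[OF f]) (use x \<open>z \<in> Z\<close> in \<open>auto simp: A_def\<close>)
    then have "h z \<in> L"
      by (rule closed_sequentially[OF compact_imp_closed[OF L(1)], rotated])
        (use x L(3) in \<open>auto simp: A_def\<close>)
    then show False using L(2) boundary_map_image(2)[OF f \<open>z \<in> Z\<close>] by blast
  qed
  then have "closure A \<subseteq> M - Z" using sub by blast
  moreover have "compact (closure A)" using compact_closed_subset[OF M] sub by auto
  ultimately show "coarsely_bounded (M - Z) (C0_structure (M - Z)) {x \<in> M - Z. f x \<in> B}"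
    unfolding coarsely_bounded_C0_iff[OF M] using closure_subset[of A] by (auto simp: A_def)
qed

text \<open>Since \<open>k \<circ> h\<close> fixes \<open>Z\<close>, both \<open>g \<circ> f\<close>
  and the identity have \<open>k \<circ> h\<close> as boundary map;
  \<open>boundary_map_controlled\<close> is applied to the diagonal.\<close>

lemma boundary_map_close_id:
  assumes M: "compact M" and f: "boundary_map M Z N W f h" and g: "boundary_map N W M Z g k"
    and kh: "\<And>z. z \<in> Z \<Longrightarrow> k (h z) = z"
  shows "close_maps (M - Z) (C0_structure (M - Z)) (g \<circ> f) id"
proof -
  have "Id_on (M - Z) \<in> C0_structure (M - Z)"
    by (auto simp: C0_structure_def intro!: exI[of _ "{}"])
  moreover have "boundary_map M Z M Z id (k \<circ> h)" using kh by (simp add: boundary_map_id)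
  ultimately have "map_prod (g \<circ> f) id ` Id_on (M - Z) \<in> C0_structure (M - Z)"
    by (intro boundary_map_controlled[OF M M boundary_map_compose[OF f g]])
  moreover have "map_prod (g \<circ> f) id ` Id_on (M - Z) = (\<lambda>s. ((g \<circ> f) s, id s)) ` (M - Z)"
    by (auto simp: Id_on_def image_UN)
  ultimately show ?thesis by (simp add: close_maps_def)
qed

section \<open>Realising a given boundary map\<close>

lemma finite_boundary_nets:
  fixes W :: "'b::metric_space set"
  assumes "compact W" "W \<subseteq> closure X" "e > 0"
  shows "\<exists>F. finite F \<and> F \<subseteq> X \<and> (\<forall>w\<in>W. \<exists>p\<in>F. dist p w < e)"
proof -
  have "W \<subseteq> (\<Union>p\<in>X. ball p e)"
    using assms(2,3) by (force simp: closure_approachable)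
  then obtain F where "F \<subseteq> X" "finite F" "W \<subseteq> (\<Union>p\<in>F. ball p e)"
    using compactE_image[OF assms(1), of X "\<lambda>p. ball p e"] by auto
  then show ?thesis by (intro exI[of _ F]) (auto simp: subset_iff)
qed

text \<open>The value at \<open>x\<close> cannot be \<open>h (c x)\<close>, which lies in
  \<open>W\<close>, so a nearby point of \<open>N - W\<close> replaces it. Shrinking mesh gives the
  limits at \<open>Z\<close>; finiteness of each net gives compactness of the image of a compact
  set. For empty \<open>Z\<close> a constant map serves, and \<open>ne\<close> supplies its
  value.\<close>

lemma boundary_map_exists:
  fixes M Z :: "'a::metric_space set" and N W :: "'b::metric_space set"
  assumes Z: "compact Z" and W: "compact W" "W \<subseteq> closure (N - W)"
    and h: "continuous_on Z h" "h ` Z \<subseteq> W"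
    and ne: "Z = {} \<Longrightarrow> M - Z = {} \<or> N - W \<noteq> {}"
  shows "\<exists>f. boundary_map M Z N W f h"
proof (cases "Z = {}")
  case True
  then obtain p where "M - Z = {} \<or> p \<in> N - W" using ne by blast
  \<comment> \<open>If \<open>M - Z\<close> is empty, \<open>p\<close> may lie outside
    \<open>N - W\<close>; the intersection keeps the compact witness inside in either case.\<close>
  then have "boundary_map M Z N W (\<lambda>_. p) h"
    using True by (auto simp: boundary_map_def intro!: exI[of _ "{p} \<inter> (N - W)"] finite_imp_compact)
  then show ?thesis by blast
next
  case False
  have "\<exists>F. finite F \<and> F \<subseteq> N - W \<and> (\<forall>w\<in>W. \<exists>p\<in>F. dist p w < inverse (real (Suc n)))" for n
    by (rule finite_boundary_nets[OF W]) simp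
  then obtain F where F: "\<And>n. finite (F n)" "\<And>n. F n \<subseteq> N - W"
    "\<And>n w. w \<in> W \<Longrightarrow> \<exists>p\<in>F n. dist p w < inverse (real (Suc n))"
    by metis
  obtain c where c: "\<And>x. c x \<in> Z" "\<And>x. infdist x Z = dist x (c x)"
    using infdist_attained_on_compact[OF Z False] by metis
  \<comment> \<open>Rounding \<open>1 / infdist x Z\<close> down and then using mesh
    \<open>1 / Suc (m x)\<close> makes the error at most \<open>infdist x Z\<close>, so it vanishes
    towards \<open>Z\<close>.\<close>
  define m where "m x = nat \<lfloor>inverse (infdist x Z)\<rfloor>" for x
  have "\<exists>p. p \<in> F (m x) \<and> dist p (h (c x)) < inverse (real (Suc (m x)))" for x
    using F(3)[of "h (c x)" "m x"] c(1)[of x] h(2) by blast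
  then obtain f where f: "\<And>x. f x \<in> F (m x)"
    "\<And>x. dist (f x) (h (c x)) < inverse (real (Suc (m x)))"
    by metis
  have pos: "infdist x Z > 0" if "x \<notin> Z" for x
    using that infdist_pos_not_in_closed[OF compact_imp_closed[OF Z] False] by blast
  have near: "dist (f x) (h (c x)) \<le> infdist x Z" if "x \<notin> Z" for x
  proof -
    have "inverse (infdist x Z) \<le> real (Suc (m x))" unfolding m_def by linarith
    then have "inverse (real (Suc (m x))) \<le> infdist x Z"
      using pos[OF that] by (metis inverse_inverse_eq inverse_positive_iff_positive le_imp_inverse_le)
    then show ?thesis using f(2)[of x] by linarith
  qed
  have lim: "(f \<longlongrightarrow> h z) (at z within M - Z)" if z: "z \<in> Z" for z
    unfolding tendsto_at_iff_sequentially comp_def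
  proof (intro allI impI)
    fix x assume x: "\<forall>i. x i \<in> M - Z - {z}" "x \<longlonglongrightarrow> z"
    have inf0: "(\<lambda>n. infdist (x n) Z) \<longlonglongrightarrow> 0"
      using tendsto_infdist[OF x(2), of Z] z by simp
    have "(\<lambda>n. c (x n)) \<longlonglongrightarrow> z"
    proof (rule tendsto_dist_bound)
      show "dist (c (x n)) z \<le> infdist (x n) Z + dist (x n) z" for n
        using dist_triangle3[of "c (x n)" z "x n"] c(2)[of "x n"] by linarith
      show "(\<lambda>n. infdist (x n) Z + dist (x n) z) \<longlonglongrightarrow> 0"
        using tendsto_add[OF inf0 iffD1[OF tendsto_dist_iff x(2)]] by simp
    qed
    then have hc: "(\<lambda>n. h (c (x n))) \<longlonglongrightarrow> h z"
      by (rule continuous_on_tendsto_compose[OF h(1) _ z]) (simp add: c(1))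
    show "(\<lambda>n. f (x n)) \<longlonglongrightarrow> h z"
    proof (rule tendsto_dist_bound)
      show "dist (f (x n)) (h z) \<le> infdist (x n) Z + dist (h (c (x n))) (h z)" for n
      proof -
        have "x n \<notin> Z" using x(1) by blast
        then show ?thesis
          using dist_triangle[of "f (x n)" "h z" "h (c (x n))"] near[of "x n"] by linarith
      qed
      show "(\<lambda>n. infdist (x n) Z + dist (h (c (x n))) (h z)) \<longlonglongrightarrow> 0"
        using tendsto_add[OF inf0 iffD1[OF tendsto_dist_iff hc]] by simp
    qed
  qed
  have bdd: "\<exists>L. compact L \<and> L \<subseteq> N - W \<and> f ` K \<subseteq> L" if K: "compact K" "K \<subseteq> M - Z" for K
  proof (cases "K = {}")
    case False
    \<comment> \<open>The distance to \<open>Z\<close> has a positive minimum on \<open>K\<close>,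
      attained at \<open>x0\<close>. Hence \<open>m\<close> is bounded on \<open>K\<close> and
      \<open>f\<close> takes only finitely many values there.\<close>
    obtain x0 where x0: "x0 \<in> K" "\<And>x. x \<in> K \<Longrightarrow> infdist x0 Z \<le> infdist x Z"
      using continuous_attains_inf[OF K(1) False continuous_on_infdist[OF continuous_on_id]]
      by blast
    have "m x \<le> m x0" if "x \<in> K" for x
      unfolding m_def
      using x0 that pos[of x0] K(2) by (intro nat_mono floor_mono le_imp_inverse_le) auto
    then have "f ` K \<subseteq> (\<Union>i\<le>m x0. F i)" using f(1) by blast
    moreover have "compact (\<Union>i\<le>m x0. F i)" using F(1) by (intro finite_imp_compact) auto
    ultimately show ?thesis using F(2) by blast
  qed auto
  have "boundary_map M Z N W f h"
    using f(1) F(2) h(2) lim bdd unfolding boundary_map_def by blast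
  then show ?thesis by blast
qed

section \<open>Extending coarse maps to the boundary\<close>

text \<open>
  The set of pairs \<open>(x n, y n)\<close> is controlled because both sequences have the same limit; its image
  is then controlled as well.
\<close>

lemma coarse_map_limits_eq:
  fixes M Z :: "'a::metric_space set" and N W :: "'b::metric_space set"
  assumes N: "compact N"
    and f: "coarse_map (M - Z) (C0_structure (M - Z)) (N - W) (C0_structure (N - W)) f"
    and x: "\<And>n. x n \<in> M - Z" "x \<longlonglongrightarrow> z" "(\<lambda>n. f (x n)) \<longlonglongrightarrow> c"
    and y: "\<And>n. y n \<in> M - Z" "y \<longlonglongrightarrow> z" "(\<lambda>n. f (y n)) \<longlonglongrightarrow> d"
    and c: "c \<in> W"
  shows "c = d"
proof -
  define E where "E = range (\<lambda>n. (x n, y n))"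
  have "E \<in> C0_structure (M - Z)"
  proof -
    have "\<exists>K. compact K \<and> K \<subseteq> M - Z \<and> (\<forall>(x, y) \<in> E - K \<times> K. dist x y < e)" if "e > 0" for e
    proof -
      have "(\<lambda>n. dist (x n) (y n)) \<longlonglongrightarrow> 0" using tendsto_dist[OF x(2) y(2)] by simp
      then have "\<forall>\<^sub>F n in sequentially. dist (x n) (y n) < e"
        by (rule order_tendstoD(2)[OF _ \<open>e > 0\<close>])
      then obtain k where k: "\<forall>n\<ge>k. dist (x n) (y n) < e"
        unfolding eventually_sequentially by blast
      \<comment> \<open>Only pairs with index below \<open>k\<close> can be \<open>e\<close> or more
        apart, so their finitely many coordinates form the compact set.\<close>
      show ?thesis
      proof (intro exI conjI)
        show "compact (x ` {..<k} \<union> y ` {..<k})" by (intro finite_imp_compact) auto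
        show "\<forall>(a, b) \<in> E - (x ` {..<k} \<union> y ` {..<k}) \<times> (x ` {..<k} \<union> y ` {..<k}). dist a b < e"
          using k by (auto simp: E_def) (meson imageI lessThan_iff not_le)+
      qed (use x y in auto)
    qed
    then show ?thesis using x(1) y(1) by (auto simp: C0_structure_def E_def)
  qed
  then have "map_prod f f ` E \<in> C0_structure (N - W)" using f by (simp add: coarse_map_def)
  moreover have "(f (x n), f (y n)) \<in> map_prod f f ` E" for n by (auto simp: E_def)
  ultimately show ?thesis
    using C0_structure_tendsto_eq[OF N _ _ x(3) y(3)] c by blast
qed

text \<open>Properness is what counts: if \<open>c\<close> were in \<open>N - W\<close>, the images
  together with \<open>c\<close> would form a bounded set. Its preimage would lie in a compact
  subset of \<open>M - Z\<close>, which would then contain the limit \<open>z\<close> of the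
  sequence.\<close>

lemma coarse_map_limit_in_boundary:
  fixes M Z :: "'a::metric_space set" and N W :: "'b::metric_space set"
  assumes M: "compact M" and N: "compact N" and W: "compact W"
    and f: "coarse_map (M - Z) (C0_structure (M - Z)) (N - W) (C0_structure (N - W)) f"
    and x: "\<And>n. x n \<in> M - Z" "x \<longlonglongrightarrow> z" "(\<lambda>n. f (x n)) \<longlonglongrightarrow> c" and z: "z \<in> Z"
  shows "c \<in> W"
proof (rule ccontr)
  assume "c \<notin> W"
  have fx: "f (x n) \<in> N - W" for n using f x(1) by (auto simp: coarse_map_def)
  have "c \<in> N" by (rule closed_sequentially[OF compact_imp_closed[OF N] _ x(3)]) (use fx in auto)
  then have "insert c (range (\<lambda>n. f (x n))) \<subseteq> N - W" using fx \<open>c \<notin> W\<close> by auto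
  then have "coarsely_bounded (N - W) (C0_structure (N - W)) (insert c (range (\<lambda>n. f (x n))))"
    unfolding coarsely_bounded_C0_iff[OF N] using compact_insert_limit_range[OF x(3)] by blast
  then have "coarsely_bounded (M - Z) (C0_structure (M - Z))
      {a \<in> M - Z. f a \<in> insert c (range (\<lambda>n. f (x n)))}"
    using f unfolding coarse_map_def by blast
  then obtain K where K: "compact K" "K \<subseteq> M - Z"
    "{a \<in> M - Z. f a \<in> insert c (range (\<lambda>n. f (x n)))} \<subseteq> K"
    unfolding coarsely_bounded_C0_iff[OF M] by blast
  have "z \<in> K"
    by (rule closed_sequentially[OF compact_imp_closed[OF K(1)] _ x(2)]) (use K(3) x(1) in blast)
  then show False using K(2) z by blast
qed

text \<open>Compactness of \<open>N\<close> yields a limit along some sequence tending to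
  \<open>z\<close>, and \<open>coarse_map_limits_eq\<close> makes it independent of the sequence.
  Continuity of \<open>h\<close> follows by approximating boundary points from inside.\<close>

lemma coarse_map_extends:
  fixes M Z :: "'a::metric_space set" and N W :: "'b::metric_space set"
  assumes M: "compact M" and N: "compact N" and W: "compact W" and dense: "Z \<subseteq> closure (M - Z)"
    and f: "coarse_map (M - Z) (C0_structure (M - Z)) (N - W) (C0_structure (N - W)) f"
  obtains h where "h ` Z \<subseteq> W" "continuous_on Z h"
    "\<And>z. z \<in> Z \<Longrightarrow> (f \<longlongrightarrow> h z) (at z within M - Z)"
proof -
  have fX: "f x \<in> N" if "x \<in> M - Z" for x using f that by (auto simp: coarse_map_def)
  have "\<exists>w. w \<in> W \<and> (f \<longlongrightarrow> w) (at z within M - Z)" if z: "z \<in> Z" for z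
  proof -
    obtain x where x: "\<forall>n. x n \<in> M - Z" "x \<longlonglongrightarrow> z"
      using subsetD[OF dense z] unfolding closure_sequential by blast
    obtain w r where w: "strict_mono r" "((\<lambda>n. f (x n)) \<circ> r) \<longlonglongrightarrow> w"
      using N fX x(1) unfolding compact_def by metis
    have xr: "\<And>n. x (r n) \<in> M - Z" "(\<lambda>n. x (r n)) \<longlonglongrightarrow> z" "(\<lambda>n. f (x (r n))) \<longlonglongrightarrow> w"
      using x(1) LIMSEQ_subseq_LIMSEQ[OF x(2) w(1)] w(2) by (auto simp: comp_def)
    have wW: "w \<in> W" by (rule coarse_map_limit_in_boundary[OF M N W f xr z])
    \<comment> \<open>Otherwise points \<open>y n\<close> tend to \<open>z\<close> with images at
      least \<open>e\<close> from \<open>w\<close>; a convergent subsequence of these images would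
      have a limit other than \<open>w\<close>.\<close>
    have "(f \<longlongrightarrow> w) (at z within M - Z)"
    proof (rule ccontr)
      assume "\<not> (f \<longlongrightarrow> w) (at z within M - Z)"
      then obtain e where e: "e > 0"
        "\<And>d. d > 0 \<Longrightarrow> \<exists>a\<in>M - Z. dist a z < d \<and> e \<le> dist (f a) w"
        unfolding Lim_within by (meson not_le)
      have "\<exists>a. a \<in> M - Z \<and> dist a z < inverse (real (Suc n)) \<and> e \<le> dist (f a) w" for n
        using e(2)[of "inverse (real (Suc n))"] by auto
      then obtain y where y: "\<And>n. y n \<in> M - Z" "\<And>n. dist (y n) z < inverse (real (Suc n))"
        "\<And>n. e \<le> dist (f (y n)) w"
        by metis
      obtain d s where d: "strict_mono s" "((\<lambda>n. f (y n)) \<circ> s) \<longlonglongrightarrow> d"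
        using N fX y(1) unfolding compact_def by metis
      have ys: "(\<lambda>n. y (s n)) \<longlonglongrightarrow> z" "(\<lambda>n. f (y (s n))) \<longlonglongrightarrow> d"
        using LIMSEQ_subseq_LIMSEQ[OF tendsto_close_sequence[OF tendsto_const y(2)] d(1)] d(2)
        by (simp_all add: comp_def)
      have "w = d" by (rule coarse_map_limits_eq[OF N f xr y(1) ys wW])
      moreover have "e \<le> dist d w"
        using tendsto_lowerbound[OF tendsto_dist[OF ys(2) tendsto_const[of w]]] y(3) by simp
      ultimately show False using e(1) by simp
    qed
    then show ?thesis using wW by blast
  qed
  then obtain h where h: "\<And>z. z \<in> Z \<Longrightarrow> h z \<in> W"
    "\<And>z. z \<in> Z \<Longrightarrow> (f \<longlongrightarrow> h z) (at z within M - Z)" by metis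
  have "continuous_on Z h"
    unfolding continuous_on_sequentially
  proof (intro allI ballI impI, elim conjE)
    fix \<zeta> z assume z: "z \<in> Z" and \<zeta>: "\<forall>n. \<zeta> n \<in> Z" "\<zeta> \<longlonglongrightarrow> z"
    \<comment> \<open>Diagonal choice: an interior point close to \<open>\<zeta> n\<close> whose
      image is equally close to \<open>h (\<zeta> n)\<close>. The limit of \<open>f\<close> at
      \<open>z\<close> then transfers to \<open>h\<close> along \<open>\<zeta>\<close>.\<close>
    have "\<exists>a\<in>M - Z. dist a (\<zeta> n) < inverse (real (Suc n)) \<and>
        dist (f a) (h (\<zeta> n)) < inverse (real (Suc n))" for n
    proof -
      have Zn: "\<zeta> n \<in> Z" using \<zeta>(1) by blast
      have e: "inverse (real (Suc n)) > 0" by simp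
      obtain d where d: "d > 0"
        "\<And>a. a \<in> M - Z \<Longrightarrow> 0 < dist a (\<zeta> n) \<Longrightarrow> dist a (\<zeta> n) < d \<Longrightarrow>
          dist (f a) (h (\<zeta> n)) < inverse (real (Suc n))"
        using h(2)[OF Zn] e unfolding Lim_within by blast
      obtain a where a: "a \<in> M - Z" "dist a (\<zeta> n) < min d (inverse (real (Suc n)))"
        using dense Zn d(1) e unfolding closure_approachable subset_iff
        by (metis min_less_iff_conj)
      \<comment> \<open>The limit of \<open>f\<close> at \<open>\<zeta> n\<close> says nothing about
        the point \<open>\<zeta> n\<close> itself.\<close>
      have "a \<noteq> \<zeta> n" using a(1) Zn by blast
      then show ?thesis using a d(2)[of a] by auto
    qed
    then obtain a where a: "\<And>n. a n \<in> M - Z" "\<And>n. dist (a n) (\<zeta> n) < inverse (real (Suc n))"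
      "\<And>n. dist (h (\<zeta> n)) (f (a n)) < inverse (real (Suc n))"
      by (metis dist_commute)
    have "a \<longlonglongrightarrow> z" by (rule tendsto_close_sequence[OF \<zeta>(2) a(2)])
    then have "(\<lambda>n. f (a n)) \<longlonglongrightarrow> h z"
      by (intro tendsto_within_sequence[OF h(2)[OF z] _ a(1)]) (use z in auto)
    then show "(h \<circ> \<zeta>) \<longlonglongrightarrow> h z"
      unfolding comp_def by (rule tendsto_close_sequence[OF _ a(3)])
  qed
  then show thesis using that h by blast
qed

text \<open>Along a sequence \<open>x\<close> tending to \<open>z\<close>, the pairs
  \<open>(g (f (x n)), x n)\<close> stay in one controlled set and tend to
  \<open>(k (h z), z)\<close>. Since \<open>z \<in> Z\<close>, the two limits agree.\<close>

lemma extensions_inverse: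
  fixes M Z :: "'a::metric_space set" and N W :: "'b::metric_space set"
  assumes M: "compact M" and dense: "Z \<subseteq> closure (M - Z)"
    and f: "f ` (M - Z) \<subseteq> N - W" "\<And>z. z \<in> Z \<Longrightarrow> (f \<longlongrightarrow> h z) (at z within M - Z)" "h ` Z \<subseteq> W"
    and g: "\<And>w. w \<in> W \<Longrightarrow> (g \<longlongrightarrow> k w) (at w within N - W)"
    and close: "close_maps (M - Z) (C0_structure (M - Z)) (g \<circ> f) id"
    and z: "z \<in> Z"
  shows "k (h z) = z"
proof -
  obtain x where x: "\<And>n. x n \<in> M - Z" "x \<longlonglongrightarrow> z"
    using subsetD[OF dense z] unfolding closure_sequential by blast
  have "(\<lambda>n. f (x n)) \<longlonglongrightarrow> h z"
    by (rule tendsto_within_sequence[OF f(2)[OF z] _ x]) (use z in auto)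
  then have gfx: "(\<lambda>n. g (f (x n))) \<longlonglongrightarrow> k (h z)"
    by (intro tendsto_within_sequence[OF g]) (use f(1,3) x(1) z in auto)
  show ?thesis
    by (rule C0_structure_tendsto_eq[OF M close[unfolded close_maps_def] _ gfx x(2)])
      (use x(1) z in auto)
qed

section \<open>Dense complements and the equivalence\<close>

text \<open>This turns nowhere density into the form used above: every point of \<open>Z\<close> is
  a limit of points of \<open>M - Z\<close>.\<close>

lemma nowhere_dense_closed_dense_complement:
  assumes "closedin (top_of_set M) Z" "nowhere_dense_in (top_of_set M) Z"
  shows "Z \<subseteq> closure (M - Z)"
proof -
  have "top_of_set M interior_of Z = {}"
    using assms closure_of_closedin[OF assms(1)] by (simp add: nowhere_dense_in_def)
  then have "top_of_set M closure_of (M - Z) = M"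
    using closure_of_complement[of "top_of_set M" Z] by simp
  then show ?thesis
    using closedin_subset[OF assms(1)] by (auto simp: closure_of_subtopology Int_absorb1)
qed

theorem corollary4p6:
  fixes M1 Z1 :: "'a::metric_space set" and M2 Z2 :: "'b::metric_space set"
  assumes "compact M1" and "compact M2"
    and "closedin (top_of_set M1) Z1" and "nowhere_dense_in (top_of_set M1) Z1"
    and "closedin (top_of_set M2) Z2" and "nowhere_dense_in (top_of_set M2) Z2"
    and "Z1 = {} \<Longrightarrow> Z2 = {} \<Longrightarrow> M1 = {} \<longleftrightarrow> M2 = {}"
  shows "coarsely_equivalent (M1 - Z1) (C0_structure (M1 - Z1)) (M2 - Z2) (C0_structure (M2 - Z2))
     \<longleftrightarrow> Z1 homeomorphic Z2"
proof
  note M = \<open>compact M1\<close> \<open>compact M2\<close>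
  have Z: "compact Z1" "compact Z2"
    using closedin_compact[OF M(1) assms(3)] closedin_compact[OF M(2) assms(5)] .
  have dense: "Z1 \<subseteq> closure (M1 - Z1)" "Z2 \<subseteq> closure (M2 - Z2)"
    using nowhere_dense_closed_dense_complement assms(3-6) by blast+
  {
    assume "coarsely_equivalent (M1 - Z1) (C0_structure (M1 - Z1)) (M2 - Z2) (C0_structure (M2 - Z2))"
    then obtain f g where
      f: "coarse_map (M1 - Z1) (C0_structure (M1 - Z1)) (M2 - Z2) (C0_structure (M2 - Z2)) f" and
      g: "coarse_map (M2 - Z2) (C0_structure (M2 - Z2)) (M1 - Z1) (C0_structure (M1 - Z1)) g" and
      gf: "close_maps (M1 - Z1) (C0_structure (M1 - Z1)) (g \<circ> f) id" and
      fg: "close_maps (M2 - Z2) (C0_structure (M2 - Z2)) (f \<circ> g) id"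
      unfolding coarsely_equivalent_def by blast
    obtain h where h: "h ` Z1 \<subseteq> Z2" "continuous_on Z1 h"
      "\<And>z. z \<in> Z1 \<Longrightarrow> (f \<longlongrightarrow> h z) (at z within M1 - Z1)"
      using coarse_map_extends[OF M Z(2) dense(1) f] by metis
    obtain k where k: "k ` Z2 \<subseteq> Z1" "continuous_on Z2 k"
      "\<And>z. z \<in> Z2 \<Longrightarrow> (g \<longlongrightarrow> k z) (at z within M2 - Z2)"
      using coarse_map_extends[OF M(2,1) Z(1) dense(2) g] by metis
    have im: "f ` (M1 - Z1) \<subseteq> M2 - Z2" "g ` (M2 - Z2) \<subseteq> M1 - Z1"
      using f g by (auto simp: coarse_map_def)
    have "k (h z) = z" if "z \<in> Z1" for z
      by (rule extensions_inverse[OF M(1) dense(1) im(1) h(3,1) k(3) gf that])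
    moreover have "h (k z) = z" if "z \<in> Z2" for z
      by (rule extensions_inverse[OF M(2) dense(2) im(2) k(3,1) h(3) fg that])
    ultimately have "homeomorphism Z1 Z2 h k"
      using h k by (intro homeomorphismI) auto
    then show "Z1 homeomorphic Z2" unfolding homeomorphic_def by blast
  }
  assume hom: "Z1 homeomorphic Z2"
  then obtain h k where hk: "homeomorphism Z1 Z2 h k" unfolding homeomorphic_def by blast
  then have h: "continuous_on Z1 h" "h ` Z1 \<subseteq> Z2" "continuous_on Z2 k" "k ` Z2 \<subseteq> Z1"
    and inv: "\<And>z. z \<in> Z1 \<Longrightarrow> k (h z) = z" "\<And>z. z \<in> Z2 \<Longrightarrow> h (k z) = z"
    by (auto simp: homeomorphism_def)
  \<comment> \<open>With both boundaries empty, no map goes from a nonempty space to an empty one.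
    The assumption on \<open>M1\<close> and \<open>M2\<close> excludes that case and provides the
    side condition of \<open>boundary_map_exists\<close>.\<close>
  have empty: "Z1 = {} \<longleftrightarrow> Z2 = {}" using h(2,4) by blast
  obtain f where f: "boundary_map M1 Z1 M2 Z2 f h"
    using boundary_map_exists[OF Z dense(2) h(1,2), of M1] empty assms(7) by auto
  obtain g where g: "boundary_map M2 Z2 M1 Z1 g k"
    using boundary_map_exists[OF Z(2,1) dense(1) h(3,4), of M2] empty assms(7) by auto
  show "coarsely_equivalent (M1 - Z1) (C0_structure (M1 - Z1)) (M2 - Z2) (C0_structure (M2 - Z2))"
    unfolding coarsely_equivalent_def
    using boundary_map_imp_coarse_map[OF M f] boundary_map_imp_coarse_map[OF M(2,1) g]
      boundary_map_close_id[OF M(1) f g inv(1)] boundary_map_close_id[OF M(2) g f inv(2)] by blast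
qed

end
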